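(* Let $q\in\mathbb{R}$ with $0<q<1$. Let $j,n\in\mathbb{Z}_+$ with $n\ge j$, and let $x_1,x_2\in[0,1]$ with $1+[x_1]_q-[x_2]_q\neq 0$. Then $$\frac{1}{(1+[x_1]_q-[x_2]_q)^{n-j}}\sum_{k=j}^{n}\frac{\binom{k}{j}}{\binom{n}{j}}\,B_{k,n}(x_1,x_2\mid q)=[x_1]_q^j.$$
   Context: $\mathbb{Z}_+=\{0,1,2,\dots\}$. For real $x$ and $0<q<1$, $[x]_q=\frac{1-q^x}{1-q}$ and $[x]_{q^{-1}}=\frac{1-q^{-x}}{1-q^{-1}}$. The extended $q$-Bernstein polynomials are defined, for $n,k\in\mathbb{Z}_+$ and $x_1,x_2\in[0,1]$, by $B_{k,n}(x_1,x_2\mid q)=\binom{n}{k}[x_1]_q^k[1-x_2]_{q^{-1}}^{n-k}$ if $n\ge k$, and $0$ if $n<k$. *)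

theory Defs
  imports Complex_Main
begin

definition q_number :: "real \<Rightarrow> real \<Rightarrow> real" where
  "q_number q x = (1 - q powr x) / (1 - q)"

text \<open>The number $[x]_{q^{-1}}$ is \<open>q_number (inverse q) x\<close>, as
  \<open>inverse q powr x = q powr (- x)\<close>.\<close>

definition ext_q_bernstein :: "nat \<Rightarrow> nat \<Rightarrow> real \<Rightarrow> real \<Rightarrow> real \<Rightarrow> real" where
  "ext_q_bernstein k n x1 x2 q =
     (if k \<le> n
      then real (n choose k) * q_number q x1 ^ k * q_number (inverse q) (1 - x2) ^ (n - k)
      else 0)"

end

theory Submission
  imports Defs
begin

text \<open>Since \<open>[1 - x]\<close> in base \<open>1/q\<close> equals \<open>1 - [x]\<close> in base \<open>q\<close>, the weighted sum is
  \<open>[x1] ^ j\<close> times the binomial expansion of \<open>(1 + [x1] - [x2]) ^ (n - j)\<close>, by the identity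
  \<open>(n choose k) (k choose j) = (n choose j) (n - j choose k - j)\<close>.\<close>

text \<open>Multiplying numerator and denominator of \<open>(1 - q powr x / q) / (1 - 1 / q)\<close>
  by \<open>q\<close> gives \<open>(q - q powr x) / (q - 1)\<close>, which is
  \<open>1 - (1 - q powr x) / (1 - q)\<close>.\<close>

lemma q_number_inverse_one_minus:
  assumes "0 < q" "q \<noteq> 1"
  shows "q_number (inverse q) (1 - x) = 1 - q_number q x"
proof -
  have "inverse q powr (1 - x) = q powr x / q"
    using assms inverse_powr[of q "1 - x"] powr_diff[of q x 1]
    by (simp flip: powr_minus)
  then show ?thesis
    using assms by (simp add: q_number_def divide_simps) (simp add: algebra_simps)
qed

lemma sum_choose_ratio_binomial:
  fixes a b :: "'a::field_char_0"
  assumes "j \<le> n"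
  shows "(\<Sum>k = j..n. of_nat (k choose j) / of_nat (n choose j) *
            (of_nat (n choose k) * a ^ k * b ^ (n - k))) = a ^ j * (a + b) ^ (n - j)"
proof -
  have "(\<Sum>k = j..n. of_nat (k choose j) / of_nat (n choose j) *
            (of_nat (n choose k) * a ^ k * b ^ (n - k)))
      = (\<Sum>k = j..n. a ^ j * (of_nat ((n - j) choose (k - j)) * a ^ (k - j) * b ^ (n - k)))"
  proof (rule sum.cong[OF refl])
    fix k assume k: "k \<in> {j..n}"
    have "(of_nat (n choose k) * of_nat (k choose j) :: 'a)
        = of_nat (n choose j) * of_nat ((n - j) choose (k - j))"
      using choose_mult[of j k n] k by (metis atLeastAtMost_iff of_nat_mult)
    \<comment> \<open>Here \<open>j \<le> n\<close> and characteristic zero enter: they allow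
      \<open>n choose j\<close> to be cancelled.\<close>
    moreover have "(of_nat (n choose j) :: 'a) \<noteq> 0"
      using assms by simp
    moreover have "a ^ k = a ^ j * a ^ (k - j)"
      using k by (simp flip: power_add)
    ultimately show "of_nat (k choose j) / of_nat (n choose j) *
            (of_nat (n choose k) * a ^ k * b ^ (n - k))
        = a ^ j * (of_nat ((n - j) choose (k - j)) * a ^ (k - j) * b ^ (n - k))"
      by (simp add: field_simps)
  qed
  \<comment> \<open>The shift \<open>i = k - j\<close> turns \<open>n - k\<close> into
    \<open>n - j - i\<close>, the exponent in the binomial theorem for \<open>n - j\<close>.\<close>
  also have "\<dots> = (\<Sum>i\<le>n - j. a ^ j * (of_nat ((n - j) choose i) * a ^ i * b ^ (n - j - i)))"
    by (rule sum.reindex_bij_witness[of _ "\<lambda>i. i + j" "\<lambda>k. k - j"]) (use assms in auto)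
  also have "\<dots> = a ^ j * (a + b) ^ (n - j)"
    by (simp add: binomial_ring sum_distrib_left)
  finally show ?thesis .
qed

theorem theorem3:
  fixes q x1 x2 :: real and j n :: nat
  assumes "0 < q" and "q < 1"
    and "j \<le> n"
    and "x1 \<in> {0..1}" and "x2 \<in> {0..1}"
    and "1 + q_number q x1 - q_number q x2 \<noteq> 0"
  shows "1 / (1 + q_number q x1 - q_number q x2) ^ (n - j) *
           (\<Sum>k = j..n. real (k choose j) / real (n choose j) * ext_q_bernstein k n x1 x2 q)
         = q_number q x1 ^ j"
proof -
  have "(\<Sum>k = j..n. real (k choose j) / real (n choose j) * ext_q_bernstein k n x1 x2 q)
      = (\<Sum>k = j..n. real (k choose j) / real (n choose j) *
          (real (n choose k) * q_number q x1 ^ k * (1 - q_number q x2) ^ (n - k)))"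
    using assms by (intro sum.cong) (auto simp: ext_q_bernstein_def q_number_inverse_one_minus)
  also have "\<dots> = q_number q x1 ^ j * (1 + q_number q x1 - q_number q x2) ^ (n - j)"
    \<comment> \<open>With these values \<open>a + b\<close> is exactly the base of the normalising
      power; as it is nonzero, that power cancels at the end.\<close>
    using sum_choose_ratio_binomial[OF \<open>j \<le> n\<close>, of "q_number q x1" "1 - q_number q x2"]
    by (simp add: algebra_simps)
  finally show ?thesis
    using assms by simp
qed

end
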